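(* Let $X$ be a stratified space with a smooth structure $C^\infty(X)$. Then smooth functions on $X$ (i.e. elements of $C^\infty(X)$) separate points on $X$.
   Context: Stratified spaces. A decomposed space is a Hausdorff paracompact finite-dimensional topological space $X$ with a locally finite collection of disjoint locally closed (smooth) manifolds $S_i\subset X$ (strata), indexed by a partially ordered set $\mathcal S$, such that $X=\bigcup_i S_i$ and $S_i\cap\bar S_j\ne\emptyset\Leftrightarrow S_i\subset\bar S_j\Leftrightarrow i\le j$. The depth of a stratum $S$ is the supremum of $n$ with strata $S=S_0<S_1<\dots<S_n$; the depth of $X$ is the supremum of the depths of its strata. For a space $L$, $cL=L\times[0,\infty)/L\times\{0\}$, $[z,t]$ is the class of $(z,t)$, and $cL(\varepsilon)=\{[z,t]\in cL: t<\varepsilon\}$. A decomposed space $X$ is a stratified space if (recursively) for each point $x$ in a stratum $S$ there are an open neighborhood $U(x)$ of $x$ in $X$, an open ball $B_x$ around $x$ in $S$, a compact stratified space $L$ (the link) and a homeomorphism $\phi_x:U(x)\to B_x\times cL(1)$ preserving the decompositions. Smooth structures. A subalgebra $C^\infty(X)$ of the algebra $C^0(X)$ of continuous real-valued functions is a $C^\infty$-ring if $G(f_1,\dots,f_n)\in C^\infty(X)$ whenever $f_i\in C^\infty(X)$, $G\in C^\infty(\mathbb R^n)$; it is germ-defined if every function that near each point coincides with an element of $C^\infty(X)$ belongs to $C^\infty(X)$. $SC^\infty(X)$ denotes the associated sheaf of functions. The product smooth structure on $Y_1\times Y_2$ is the germ-defined $C^\infty$-ring whose sheaf is generated by $\pi_1^*SC^\infty(Y_1)$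 and $\pi_2^*SC^\infty(Y_2)$, i.e. its elements are locally of the form $G(\pi_1^*f_1,\dots,\pi_1^*f_n,\pi_2^*h_1,\dots,\pi_2^*h_k)$ with $G$ smooth, $f_i,h_j$ smooth on $Y_1,Y_2$. A smooth structure on a stratified space $X$ is (recursively on the depth) a choice of an $\mathbb R$-subalgebra $C^\infty(X)\subset C^0(X)$ such that: (1) $C^\infty(X)$ is a germ-defined $C^\infty$-ring; (2) for any $x\in X$ there is a local trivialization $\phi_x:U(x)\to B_x\times cL(1)$ with $C^\infty(U(x))=\phi_x^*(C^\infty(B_x\times cL(1)))$, where $C^\infty(B_x\times cL(1))$ is the product smooth structure of the usual smooth functions on $B_x$ and a smooth structure on $cL(1)$; (3) a smooth structure $C^\infty(cL(1))$ on the cone over a compact stratified space $L$ (with its smooth structure) must satisfy (3a) $C^\infty(cL(1))|_{L\times(0,1)}\subset C^\infty(L\times(0,1))$ (product smooth structure) and (3b) $j_*[\pi_1^*(C^\infty_{u,0}(0,1))]\subset C^\infty(cL(1))$, where $\pi_1:L\times(0,1)\to(0,1)$ is the projection, $C^\infty_{u,0}(0,1)$ is the space of usual smooth compactly supported functions and $j_*$ is extension by zero. *)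

theory Defs
  imports "HOL-Analysis.Analysis"
begin

text \<open>
  Spaces are abstract topologies. A real function on a space \<open>X\<close> is a total function on the ambient
  type whose values outside \<open>topspace X\<close> are irrelevant: every set of functions below that is an
  actual function space is closed under changing its members outside the carrier.
\<close>

section \<open>Topological preliminaries\<close>

definition paracompact_in :: "'a topology \<Rightarrow> bool" where
  "paracompact_in X \<longleftrightarrow>
     (\<forall>\<U>. (\<forall>U\<in>\<U>. openin X U) \<and> \<Union>\<U> = topspace X \<longrightarrow>
        (\<exists>\<V>. (\<forall>V\<in>\<V>. openin X V \<and> (\<exists>U\<in>\<U>. V \<subseteq> U)) \<and> \<Union>\<V> = topspace X \<and>
             locally_finite_in X \<V>))"

text \<open>Finite Lebesgue covering dimension.\<close>

definition covering_dim_le :: "'a topology \<Rightarrow> nat \<Rightarrow> bool" where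
  "covering_dim_le X n \<longleftrightarrow>
     (\<forall>\<U>. (\<forall>U\<in>\<U>. openin X U) \<and> \<Union>\<U> = topspace X \<longrightarrow>
        (\<exists>\<V>. (\<forall>V\<in>\<V>. openin X V \<and> (\<exists>U\<in>\<U>. V \<subseteq> U)) \<and> \<Union>\<V> = topspace X \<and>
             (\<forall>x\<in>topspace X. finite {V\<in>\<V>. x \<in> V} \<and> card {V\<in>\<V>. x \<in> V} \<le> n + 1)))"

definition finite_dimensional :: "'a topology \<Rightarrow> bool" where
  "finite_dimensional X \<longleftrightarrow> (\<exists>n. covering_dim_le X n)"

definition locally_closed_in :: "'a topology \<Rightarrow> 'a set \<Rightarrow> bool" where
  "locally_closed_in X S \<longleftrightarrow> (\<exists>U F. openin X U \<and> closedin X F \<and> S = U \<inter> F)"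

section \<open>Smooth functions on open subsets of \<open>\<real>\<^sup>n\<close>\<close>

text \<open>
  The dimension varies with the stratum, so \<open>\<real>\<^sup>n\<close> is \<^const>\<open>Euclidean_space\<close> \<open>n\<close>: sequences of reals that
  vanish from index \<open>n\<close> on.
\<close>

definition partial_deriv :: "nat \<Rightarrow> ((nat \<Rightarrow> real) \<Rightarrow> real) \<Rightarrow> (nat \<Rightarrow> real) \<Rightarrow> real" where
  "partial_deriv i f x = deriv (\<lambda>t. f (x(i := t))) (x i)"

text \<open>All iterated partial derivatives exist and are continuous on the open set \<open>W\<close>.\<close>

definition smooth_on_Rn :: "nat \<Rightarrow> (nat \<Rightarrow> real) set \<Rightarrow> ((nat \<Rightarrow> real) \<Rightarrow> real) \<Rightarrow> bool" where
  "smooth_on_Rn n W f \<longleftrightarrow>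
     (\<forall>js. set js \<subseteq> {..<n} \<longrightarrow>
        continuous_map (subtopology (Euclidean_space n) W) euclideanreal (foldr partial_deriv js f) \<and>
        (\<forall>i<n. \<forall>x\<in>W. (\<lambda>t. foldr partial_deriv js f (x(i := t))) differentiable (at (x i))))"

definition smooth_Rn :: "nat \<Rightarrow> ((nat \<Rightarrow> real) \<Rightarrow> real) \<Rightarrow> bool" where
  "smooth_Rn n G \<longleftrightarrow> smooth_on_Rn n (topspace (Euclidean_space n)) G"

definition tuple :: "nat \<Rightarrow> (nat \<Rightarrow> real) \<Rightarrow> nat \<Rightarrow> real" where
  "tuple n v = (\<lambda>i. if i < n then v i else 0)"

definition smooth_unit_interval :: "(real \<Rightarrow> real) set" where
  "smooth_unit_interval = {g. \<forall>k. \<forall>t\<in>{0<..<1}. (deriv ^^ k) g differentiable (at t)}"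

definition smooth_unit_interval_cpt :: "(real \<Rightarrow> real) set" where
  "smooth_unit_interval_cpt =
     {g \<in> smooth_unit_interval. \<exists>K. compact K \<and> K \<subseteq> {0<..<1} \<and> (\<forall>t\<in>{0<..<1} - K. g t = 0)}"

section \<open>Smooth manifolds inside a space\<close>

record 'a stratum =
  pts :: "'a set"
  sdim :: nat
  atlas :: "('a set \<times> ('a \<Rightarrow> nat \<Rightarrow> real)) set"

definition is_chart :: "'a topology \<Rightarrow> 'a set \<Rightarrow> nat \<Rightarrow> 'a set \<times> ('a \<Rightarrow> nat \<Rightarrow> real) \<Rightarrow> bool" where
  "is_chart X S n = (\<lambda>(V, \<psi>). openin (subtopology X S) V \<and> openin (Euclidean_space n) (\<psi> ` V) \<and>
     homeomorphic_map (subtopology X V) (subtopology (Euclidean_space n) (\<psi> ` V)) \<psi>)"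

definition smooth_transition ::
    "nat \<Rightarrow> 'a set \<times> ('a \<Rightarrow> nat \<Rightarrow> real) \<Rightarrow> 'a set \<times> ('a \<Rightarrow> nat \<Rightarrow> real) \<Rightarrow> bool" where
  "smooth_transition n = (\<lambda>(V, \<psi>) (V', \<psi>').
     \<forall>i<n. smooth_on_Rn n (\<psi> ` (V \<inter> V')) (\<lambda>y. \<psi>' (inv_into V \<psi> y) i))"

definition smooth_manifold_in :: "'a topology \<Rightarrow> 'a stratum \<Rightarrow> bool" where
  "smooth_manifold_in X S \<longleftrightarrow>
     pts S \<subseteq> topspace X \<and>
     Hausdorff_space (subtopology X (pts S)) \<and> paracompact_in (subtopology X (pts S)) \<and>
     (\<forall>c\<in>atlas S. is_chart X (pts S) (sdim S) c) \<and>
     (\<Union>c\<in>atlas S. fst c) = pts S \<and>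
     (\<forall>c\<in>atlas S. \<forall>c'\<in>atlas S. smooth_transition (sdim S) c c')"

text \<open>\<open>B\<close> is mapped onto a round ball about the image of \<open>x\<close> by a chart of the maximal atlas.\<close>

definition open_ball_around :: "'a topology \<Rightarrow> 'a stratum \<Rightarrow> 'a \<Rightarrow> 'a set \<Rightarrow> bool" where
  "open_ball_around X S x B \<longleftrightarrow> x \<in> B \<and>
     (\<exists>\<kappa> r. r > 0 \<and> is_chart X (pts S) (sdim S) (B, \<kappa>) \<and>
        (\<forall>c\<in>atlas S. smooth_transition (sdim S) (B, \<kappa>) c \<and> smooth_transition (sdim S) c (B, \<kappa>)) \<and>
        \<kappa> ` B = {y \<in> topspace (Euclidean_space (sdim S)). (\<Sum>i<sdim S. (y i - \<kappa> x i)\<^sup>2) < r\<^sup>2})"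

definition stratum_smooth :: "'a stratum \<Rightarrow> 'a set \<Rightarrow> ('a \<Rightarrow> real) set" where
  "stratum_smooth S B =
     {f. \<forall>(V, \<psi>)\<in>atlas S. smooth_on_Rn (sdim S) (\<psi> ` (V \<inter> B)) (\<lambda>y. f (inv_into V \<psi> y))}"

section \<open>Decomposed spaces\<close>

record 'a decomposed =
  base :: "'a topology"
  strata :: "'a stratum set"

text \<open>
  The strata are indexed by themselves. This loses nothing: reflexivity of the order forces strata
  to be nonempty, so a disjoint family of strata is automatically injective.
\<close>

definition decomposed_space :: "'a decomposed \<Rightarrow> bool" where
  "decomposed_space X \<longleftrightarrow>
     Hausdorff_space (base X) \<and> paracompact_in (base X) \<and> finite_dimensional (base X) \<and>
     locally_finite_in (base X) (pts ` strata X) \<and>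
     (\<forall>S\<in>strata X. locally_closed_in (base X) (pts S) \<and> smooth_manifold_in (base X) S) \<and>
     (\<forall>S\<in>strata X. \<forall>T\<in>strata X. S \<noteq> T \<longrightarrow> disjnt (pts S) (pts T)) \<and>
     (\<Union>S\<in>strata X. pts S) = topspace (base X) \<and>
     (\<exists>le. partial_order_on (strata X) le \<and>
        (\<forall>S\<in>strata X. \<forall>T\<in>strata X.
           (pts S \<inter> (base X closure_of pts T) \<noteq> {} \<longleftrightarrow> pts S \<subseteq> base X closure_of pts T) \<and>
           (pts S \<subseteq> base X closure_of pts T \<longleftrightarrow> (S, T) \<in> le)))"

section \<open>Cones\<close>

text \<open>
  \<open>Ray z t\<close> with \<open>t > 0\<close> is the class of \<open>(z, t)\<close> and \<open>Apex\<close> is the class of \<open>L \<times> {0}\<close>. By the usual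
  convention the cone over the empty space is a point.
\<close>

datatype 'b cone = Apex | Ray 'b real

definition cone_class :: "'b \<Rightarrow> real \<Rightarrow> 'b cone" where
  "cone_class z t = (if t = 0 then Apex else Ray z t)"

definition cone_points :: "'b set \<Rightarrow> 'b cone set" where
  "cone_points A = insert Apex {Ray z t | z t. z \<in> A \<and> 0 < t}"

text \<open>Quotient topology of \<open>L \<times> [0, \<infinity>)\<close>.\<close>

definition cone_topology :: "'b topology \<Rightarrow> 'b cone topology" where
  "cone_topology L = topology (\<lambda>W. W \<subseteq> cone_points (topspace L) \<and>
     openin (prod_topology L (top_of_set {0..}))
       {(z, t). z \<in> topspace L \<and> 0 \<le> t \<and> cone_class z t \<in> W})"

lemma openin_cone_topology:
  "openin (cone_topology L) W \<longleftrightarrow> W \<subseteq> cone_points (topspace L) \<and>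
     openin (prod_topology L (top_of_set {0..}))
       {(z, t). z \<in> topspace L \<and> 0 \<le> t \<and> cone_class z t \<in> W}"
proof -
  let ?T = "prod_topology L (top_of_set {0::real..})"
  let ?pre = "\<lambda>W. {(z, t). z \<in> topspace L \<and> 0 \<le> t \<and> cone_class z t \<in> W}"
  have "istopology (\<lambda>W. W \<subseteq> cone_points (topspace L) \<and> openin ?T (?pre W))"
    unfolding istopology_def
  proof (intro conjI allI impI)
    fix S T
    assume S: "S \<subseteq> cone_points (topspace L) \<and> openin ?T (?pre S)"
      and T: "T \<subseteq> cone_points (topspace L) \<and> openin ?T (?pre T)"
    have "?pre (S \<inter> T) = ?pre S \<inter> ?pre T" by auto
    with S T show "openin ?T (?pre (S \<inter> T))" by auto
  next
    fix \<K> assume K: "\<forall>W\<in>\<K>. W \<subseteq> cone_points (topspace L) \<and> openin ?T (?pre W)"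
    have "?pre (\<Union>\<K>) = (\<Union>W\<in>\<K>. ?pre W)" by auto
    with K show "openin ?T (?pre (\<Union>\<K>))" by auto
  qed (auto)
  then show ?thesis
    unfolding cone_topology_def by (simp add: topology_inverse')
qed

definition apex_stratum :: "'b cone stratum" where
  "apex_stratum = \<lparr>pts = {Apex}, sdim = 0, atlas = {({Apex}, \<lambda>_ _. 0)}\<rparr>"

text \<open>The product manifold of a stratum \<open>S\<close> of the link with \<open>(0, \<epsilon>)\<close>; the radius is the last coordinate.\<close>

definition cone_stratum :: "real \<Rightarrow> 'b stratum \<Rightarrow> 'b cone stratum" where
  "cone_stratum \<epsilon> S =
     \<lparr>pts = {Ray z t | z t. z \<in> pts S \<and> 0 < t \<and> t < \<epsilon>},
      sdim = Suc (sdim S),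
      atlas = (\<lambda>(V, \<psi>). ({Ray z t | z t. z \<in> V \<and> 0 < t \<and> t < \<epsilon>},
                 \<lambda>c. case c of Apex \<Rightarrow> (\<lambda>_. 0) | Ray z t \<Rightarrow> (\<psi> z)(sdim S := t))) ` atlas S\<rparr>"

definition cone_ball :: "'b decomposed \<Rightarrow> real \<Rightarrow> 'b cone decomposed" where
  "cone_ball L \<epsilon> =
     \<lparr>base = subtopology (cone_topology (base L))
               (insert Apex {Ray z t | z t. 0 < t \<and> t < \<epsilon>}),
      strata = insert apex_stratum (cone_stratum \<epsilon> ` strata L)\<rparr>"

section \<open>Stratified spaces\<close>

text \<open>
  Preserving the decompositions: the nonempty traces on \<open>U\<close> of the strata are mapped exactly onto the
  pieces \<open>B \<times> R\<close>, where \<open>R\<close> ranges over the strata of \<open>cL(1)\<close>; the stratum of \<open>x\<close> corresponds to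
  \<open>B \<times> {Apex}\<close> (for dimension reasons no other piece could occur, as \<open>B\<close> is open in \<open>S\<close>).
\<close>

definition local_trivialization ::
    "'a decomposed \<Rightarrow> 'a \<Rightarrow> 'a stratum \<Rightarrow> 'a set \<Rightarrow> 'a set \<Rightarrow> 'b decomposed \<Rightarrow> ('a \<Rightarrow> 'a \<times> 'b cone) \<Rightarrow> bool"
  where
  "local_trivialization X x S U B L \<phi> \<longleftrightarrow>
     S \<in> strata X \<and> x \<in> pts S \<and> openin (base X) U \<and> x \<in> U \<and> open_ball_around (base X) S x B \<and>
     homeomorphic_map (subtopology (base X) U)
       (prod_topology (subtopology (base X) B) (base (cone_ball L 1))) \<phi> \<and>
     {\<phi> ` (U \<inter> pts T) | T. T \<in> strata X \<and> U \<inter> pts T \<noteq> {}} =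
       {B \<times> pts R | R. R \<in> strata (cone_ball L 1)} \<and>
     \<phi> ` (U \<inter> pts S) = B \<times> {Apex}"

definition locally_conical :: "('b decomposed \<Rightarrow> bool) \<Rightarrow> 'a decomposed \<Rightarrow> bool" where
  "locally_conical P X \<longleftrightarrow> decomposed_space X \<and>
     (\<forall>x\<in>topspace (base X). \<exists>S U B L \<phi>.
        P L \<and> compact_space (base L) \<and> local_trivialization X x S U B L \<phi>)"

lemma locally_conical_mono [mono]:
  "(\<And>L. P L \<longrightarrow> Q L) \<Longrightarrow> locally_conical P X \<longrightarrow> locally_conical Q X"
  unfolding locally_conical_def by fast

text \<open>
  All links, links of links, etc. have their points in one type \<open>'b\<close>, which is independent of the
  type of \<open>X\<close> and appears as a type argument of the top-level notions, so that theorems about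
  \<open>stratified_space TYPE('b)\<close> hold for every choice of \<open>'b\<close>. (Any type with at least continuum many
  elements accommodates all compact stratified spaces up to isomorphism.)

  The recursion of the definition is an inductive predicate: a link has smaller depth than the
  space, so unfolding the definition terminates.
\<close>

inductive stratified_link :: "'b decomposed \<Rightarrow> bool" where
  "locally_conical stratified_link L \<Longrightarrow> stratified_link L"

definition stratified_space :: "'b itself \<Rightarrow> 'a decomposed \<Rightarrow> bool" where
  "stratified_space _ X \<longleftrightarrow> locally_conical (stratified_link :: 'b decomposed \<Rightarrow> bool) X"

section \<open>Smooth structures\<close>

definition subalgebra_C0 :: "'a topology \<Rightarrow> ('a \<Rightarrow> real) set \<Rightarrow> bool" where
  "subalgebra_C0 X C \<longleftrightarrow>
     (\<forall>f\<in>C. continuous_map X euclideanreal f) \<and>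
     (\<forall>a. (\<lambda>_. a) \<in> C) \<and>
     (\<forall>f\<in>C. \<forall>g\<in>C. (\<lambda>x. f x + g x) \<in> C \<and> (\<lambda>x. f x * g x) \<in> C) \<and>
     (\<forall>a. \<forall>f\<in>C. (\<lambda>x. a * f x) \<in> C)"

definition Cinfty_ring :: "('a \<Rightarrow> real) set \<Rightarrow> bool" where
  "Cinfty_ring C \<longleftrightarrow>
     (\<forall>n G f. smooth_Rn n G \<and> (\<forall>i<n. f i \<in> C) \<longrightarrow> (\<lambda>x. G (tuple n (\<lambda>i. f i x))) \<in> C)"

text \<open>Sections over \<open>U\<close> of the sheaf associated with \<open>C\<close>.\<close>

definition sheaf_sections :: "'a topology \<Rightarrow> ('a \<Rightarrow> real) set \<Rightarrow> 'a set \<Rightarrow> ('a \<Rightarrow> real) set" where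
  "sheaf_sections X C U =
     {f. \<forall>x\<in>U. \<exists>V. openin X V \<and> x \<in> V \<and> V \<subseteq> U \<and> (\<exists>g\<in>C. \<forall>y\<in>V. f y = g y)}"

definition germ_defined :: "'a topology \<Rightarrow> ('a \<Rightarrow> real) set \<Rightarrow> bool" where
  "germ_defined X C \<longleftrightarrow> sheaf_sections X C (topspace X) \<subseteq> C"

definition smooth_algebra :: "'a topology \<Rightarrow> ('a \<Rightarrow> real) set \<Rightarrow> bool" where
  "smooth_algebra X C \<longleftrightarrow> subalgebra_C0 X C \<and> germ_defined X C \<and> Cinfty_ring C"

definition product_smooth ::
    "'a topology \<Rightarrow> ('a \<Rightarrow> real) set \<Rightarrow> 'b topology \<Rightarrow> ('b \<Rightarrow> real) set \<Rightarrow> ('a \<times> 'b \<Rightarrow> real) set" where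
  "product_smooth Y1 C1 Y2 C2 =
     {F. \<forall>p\<in>topspace (prod_topology Y1 Y2). \<exists>W. openin (prod_topology Y1 Y2) W \<and> p \<in> W \<and>
        (\<exists>n k G f h. smooth_Rn (n + k) G \<and> (\<forall>i<n. f i \<in> C1) \<and> (\<forall>j<k. h j \<in> C2) \<and>
           (\<forall>(y, z)\<in>W. F (y, z) = G (tuple (n + k) (\<lambda>i. if i < n then f i y else h (i - n) z))))}"

text \<open>
  The condition at a point \<open>x\<close> that some local trivialization carries \<open>C\<close> to a product smooth
  structure; \<open>Q L K\<close> says that \<open>K\<close> is a smooth structure on \<open>cL(1)\<close>.
\<close>

definition smooth_local_model ::
    "('b decomposed \<Rightarrow> ('b cone \<Rightarrow> real) set \<Rightarrow> bool) \<Rightarrow> 'a decomposed \<Rightarrow> ('a \<Rightarrow> real) set \<Rightarrow> 'a \<Rightarrow> bool"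
  where
  "smooth_local_model Q X C x \<longleftrightarrow>
     (\<exists>S U B L \<phi> K. local_trivialization X x S U B L \<phi> \<and> Q L K \<and>
        sheaf_sections (base X) C U =
          {f. \<exists>F \<in> product_smooth (subtopology (base X) B) (stratum_smooth S B)
                     (base (cone_ball L 1)) K.
                \<forall>u\<in>U. f u = F (\<phi> u)})"

definition smooth_structure_rel ::
    "('b decomposed \<Rightarrow> ('b cone \<Rightarrow> real) set \<Rightarrow> bool) \<Rightarrow> 'a decomposed \<Rightarrow> ('a \<Rightarrow> real) set \<Rightarrow> bool"
  where
  "smooth_structure_rel Q X C \<longleftrightarrow>
     smooth_algebra (base X) C \<and> (\<forall>x\<in>topspace (base X). smooth_local_model Q X C x)"

lemma smooth_local_model_mono [mono]:
  "(\<And>L K. P L K \<longrightarrow> Q L K) \<Longrightarrow> smooth_local_model P X C x \<longrightarrow> smooth_local_model Q X C x"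
  unfolding smooth_local_model_def by (intro ex_mono conj_mono imp_refl)

lemma smooth_structure_rel_mono [mono]:
  "(\<And>L K. P L K \<longrightarrow> Q L K) \<Longrightarrow> smooth_structure_rel P X C \<longrightarrow> smooth_structure_rel Q X C"
  unfolding smooth_structure_rel_def using smooth_local_model_mono[of P Q X C] by simp

text \<open>
  \<open>smooth_cone L K\<close>: \<open>K\<close> is a smooth structure on \<open>cL(1)\<close>, where the compact stratified space \<open>L\<close>
  carries some smooth structure \<open>C\<close>. The local condition is required at all points but the apex:
  there the trivialization is \<open>cL(1)\<close> itself, for which a smooth structure is what is being defined,
  and the last two conditions take its place. In them \<open>L \<times> (0, 1)\<close> is identified with the complement
  of the apex, and functions on \<open>(0, 1)\<close> are extended by zero to the apex.
\<close>

inductive smooth_cone :: "'b decomposed \<Rightarrow> ('b cone \<Rightarrow> real) set \<Rightarrow> bool" where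
  "\<lbrakk>stratified_link L; compact_space (base L);
    smooth_structure_rel smooth_cone L C;
    smooth_algebra (base (cone_ball L 1)) K;
    \<forall>y\<in>topspace (base (cone_ball L 1)) - {Apex}. smooth_local_model smooth_cone (cone_ball L 1) K y;
    \<forall>f\<in>K. (\<lambda>(z, t). f (Ray z t)) \<in>
             product_smooth (base L) C (top_of_set {0<..<1}) smooth_unit_interval;
    \<forall>g\<in>smooth_unit_interval_cpt. (\<lambda>c. case c of Apex \<Rightarrow> 0 | Ray z t \<Rightarrow> g t) \<in> K\<rbrakk>
   \<Longrightarrow> smooth_cone L K"

definition smooth_structure :: "'b itself \<Rightarrow> 'a decomposed \<Rightarrow> ('a \<Rightarrow> real) set \<Rightarrow> bool" where
  "smooth_structure _ X C \<longleftrightarrow>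
     smooth_structure_rel (smooth_cone :: 'b decomposed \<Rightarrow> ('b cone \<Rightarrow> real) set \<Rightarrow> bool) X C"

definition separates_points :: "'a topology \<Rightarrow> ('a \<Rightarrow> real) set \<Rightarrow> bool" where
  "separates_points X C \<longleftrightarrow>
     (\<forall>x\<in>topspace X. \<forall>y\<in>topspace X. x \<noteq> y \<longrightarrow> (\<exists>f\<in>C. f x \<noteq> f y))"

end

(*
  In a local trivialization around x, take the product of a bump function in the chart coordinates of
  the ball B and of a radial cutoff on the cone cL(1). The support of the product is compact, as the
  link is, hence closed in the Hausdorff space X, and extension by zero gives an element of the
  germ-defined algebra C. Shrinking the supports makes it vanish at a given point other than x.
  The bump function on B is a product of one-variable bumps in the chart coordinates, which lie in
  stratum_smooth by smooth_transition; only smoothness of a function on R^n is to be checked.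
*)
theory Submission
  imports Defs
begin

section \<open>Smooth functions of one real variable\<close>

definition smooth_real :: "(real \<Rightarrow> real) \<Rightarrow> bool" where
  "smooth_real g \<longleftrightarrow> (\<forall>k t. (deriv ^^ k) g differentiable (at t))"

lemma smooth_real_deriv: "smooth_real g \<Longrightarrow> smooth_real (deriv g)"
  unfolding smooth_real_def
proof (intro allI)
  fix k t
  assume "\<forall>k t. (deriv ^^ k) g differentiable (at t)"
  then have "(deriv ^^ Suc k) g differentiable (at t)" by blast
  then show "(deriv ^^ k) (deriv g) differentiable (at t)" by (simp only: funpow_Suc_right comp_apply)
qed

lemma smooth_real_has_deriv: "smooth_real g \<Longrightarrow> (g has_real_derivative deriv g t) (at t)"
  unfolding smooth_real_def DERIV_deriv_iff_real_differentiable by (drule spec[of _ 0]) simp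

lemma smooth_real_continuous: "smooth_real g \<Longrightarrow> continuous_on A g"
  by (meson DERIV_isCont continuous_at_imp_continuous_on smooth_real_has_deriv)

text \<open>The case \<open>n = 0\<close> is the classical function \<open>exp (-1/t)\<close>
  extended by zero. The extra power of \<open>1/t\<close> is there because differentiation produces
  such factors: the derivative of \<open>flat n\<close> combines \<open>flat (n + 1)\<close> and
  \<open>flat (n + 2)\<close>.\<close>

definition flat :: "nat \<Rightarrow> real \<Rightarrow> real" where
  "flat n t = (if 0 < t then inverse t ^ n * exp (- inverse t) else 0)"

lemma flat_pos: "0 < t \<Longrightarrow> 0 < flat n t"
  and flat_nonpos: "t \<le> 0 \<Longrightarrow> flat n t = 0"
  by (auto simp: flat_def)

text \<open>To the right of 0, the substitution \<open>u = 1/t\<close> turns the claim into the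
  decay of \<open>u ^ n / exp u\<close> at infinity.\<close>

lemma flat_tendsto_0: "(flat n \<longlongrightarrow> 0) (at 0)"
proof (rule filterlim_split_at)
  show "(flat n \<longlongrightarrow> 0) (at_left 0)"
    by (rule tendsto_eventually) (auto simp: eventually_at_filter flat_def)
  have "((\<lambda>t::real. inverse t ^ n / exp (inverse t)) \<longlongrightarrow> 0) (at_right 0)"
    by (rule filterlim_compose[OF tendsto_power_div_exp_0 filterlim_inverse_at_top_right])
  then show "(flat n \<longlongrightarrow> 0) (at_right 0)"
    by (rule Lim_transform_eventually)
      (auto simp: eventually_at_filter flat_def exp_minus divide_inverse)
qed

lemma flat_has_derivative:
  "(flat n has_real_derivative flat (n + 2) t - real n * flat (n + 1) t) (at t)"
proof -
  consider "t < 0" | "t = 0" | "0 < t" by linarith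
  then show ?thesis
  proof cases
    case 1
    have "((\<lambda>_. 0) has_real_derivative 0) (at t)" by simp
    then have "(flat n has_real_derivative 0) (at t)"
      by (rule has_field_derivative_transform_within_open[of _ _ _ "{..<0}"])
        (use 1 in \<open>auto simp: flat_def\<close>)
    with 1 show ?thesis by (simp add: flat_def)
  next
    case 2
    \<comment> \<open>The difference quotient of \<open>flat n\<close> at 0 is
      \<open>flat (Suc n)\<close> itself, so the limit just proved is the derivative at 0.\<close>
    have "(\<lambda>h. (flat n (0 + h) - flat n 0) / h) \<midarrow>0\<rightarrow> 0"
      by (rule Lim_transform_eventually[OF flat_tendsto_0[of "Suc n"]])
        (auto simp: eventually_at_filter flat_def divide_inverse)
    with 2 show ?thesis by (simp add: DERIV_def flat_def)
  next
    case 3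
    have "((\<lambda>t. inverse t ^ n) has_real_derivative - real n * inverse t ^ (n + 1)) (at t)"
    proof (rule DERIV_cong[OF DERIV_power[OF DERIV_inverse]])
      show "t \<noteq> 0" using 3 by simp
      show "real n * (- (inverse t ^ Suc (Suc 0)) * inverse t ^ (n - Suc 0)) = - real n * inverse t ^ (n + 1)"
        by (cases n) (simp_all add: algebra_simps)
    qed
    moreover have "((\<lambda>t. exp (- inverse t)) has_real_derivative exp (- inverse t) * (inverse t)\<^sup>2) (at t)"
      using 3 by (auto intro!: derivative_eq_intros simp: power2_eq_square)
    ultimately have "((\<lambda>t. inverse t ^ n * exp (- inverse t)) has_real_derivative
             inverse t ^ (n + 2) * exp (- inverse t) - real n * (inverse t ^ (n + 1) * exp (- inverse t))) (at t)"
      by (rule DERIV_cong[OF DERIV_mult]) (simp add: power2_eq_square algebra_simps)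
    then have "(flat n has_real_derivative
             inverse t ^ (n + 2) * exp (- inverse t) - real n * (inverse t ^ (n + 1) * exp (- inverse t))) (at t)"
      by (rule has_field_derivative_transform_within_open[of _ _ _ "{0<..}"])
        (use 3 in \<open>auto simp: flat_def\<close>)
    with 3 show ?thesis by (simp add: flat_def)
  qed
qed

text \<open>
  Smoothness of the functions built from \<^const>\<open>flat\<close> needs no product or chain rule for higher
  derivatives: it suffices that they form a class closed under taking one derivative.
\<close>

inductive_set flat_algebra :: "(real \<Rightarrow> real) set" where
  const: "(\<lambda>_. c) \<in> flat_algebra"
| flat: "(\<lambda>t. flat n (c * t + d)) \<in> flat_algebra"
| add: "f \<in> flat_algebra \<Longrightarrow> g \<in> flat_algebra \<Longrightarrow> (\<lambda>t. f t + g t) \<in> flat_algebra"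
| mult: "f \<in> flat_algebra \<Longrightarrow> g \<in> flat_algebra \<Longrightarrow> (\<lambda>t. f t * g t) \<in> flat_algebra"

lemma flat_algebra_has_derivative:
  "f \<in> flat_algebra \<Longrightarrow> \<exists>f'\<in>flat_algebra. \<forall>t. (f has_real_derivative f' t) (at t)"
proof (induction rule: flat_algebra.induct)
  case (const c)
  show ?case by (rule bexI[OF _ flat_algebra.const[of 0]]) simp
next
  case (flat n c d)
  \<comment> \<open>The difference appears as a sum with coefficient \<open>- real n\<close>, so
    that the closure rules of \<open>flat_algebra\<close> match it syntactically.\<close>
  let ?f' = "\<lambda>t. c * (flat (n + 2) (c * t + d) + (- real n) * flat (n + 1) (c * t + d))"
  have "?f' \<in> flat_algebra"
    by (intro flat_algebra.intros)
  moreover have "((\<lambda>t. flat n (c * t + d)) has_real_derivative ?f' t) (at t)" for t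
    by (rule DERIV_cong[OF DERIV_chain2[OF flat_has_derivative]])
      (auto intro!: derivative_eq_intros)
  ultimately show ?case by (intro bexI[of _ ?f'] allI)
next
  case (add f g)
  then obtain f' g' where "f' \<in> flat_algebra" "g' \<in> flat_algebra"
    "\<And>t. (f has_real_derivative f' t) (at t)" "\<And>t. (g has_real_derivative g' t) (at t)"
    by blast
  then show ?case
    by (intro bexI[of _ "\<lambda>t. f' t + g' t"] allI DERIV_add flat_algebra.intros)
next
  case (mult f g)
  then obtain f' g' where "f' \<in> flat_algebra" "g' \<in> flat_algebra"
    "\<And>t. (f has_real_derivative f' t) (at t)" "\<And>t. (g has_real_derivative g' t) (at t)"
    by blast
  with mult show ?case
    by (intro bexI[of _ "\<lambda>t. f' t * g t + g' t * f t"] allI DERIV_mult flat_algebra.intros)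
qed

lemma smooth_real_flat_algebra:
  assumes "f \<in> flat_algebra" shows "smooth_real f"
proof -
  have *: "deriv f \<in> flat_algebra" if f: "f \<in> flat_algebra" for f
  proof -
    obtain f' where "f' \<in> flat_algebra" "\<forall>t. (f has_real_derivative f' t) (at t)"
      using flat_algebra_has_derivative[OF f] by blast
    moreover from this have "deriv f = f'" by (auto intro: DERIV_imp_deriv)
    ultimately show ?thesis by simp
  qed
  have "(deriv ^^ k) f \<in> flat_algebra" for k
    by (induction k) (auto simp: assms *)
  then show ?thesis
    unfolding smooth_real_def using flat_algebra_has_derivative real_differentiable_def by blast
qed

lemma smooth_real_flat_reflect: "smooth_real (\<lambda>t. flat n (c - t))"
  using smooth_real_flat_algebra[OF flat_algebra.flat[of n "-1" c]] by simp

section \<open>Bump functions on an interval\<close>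

definition bump :: "real \<Rightarrow> real \<Rightarrow> real \<Rightarrow> real" where
  "bump a b t = flat 0 (t - a) * flat 0 (b - t)"

lemma smooth_real_bump: "smooth_real (bump a b)"
proof -
  have "(\<lambda>t. flat 0 (1 * t + (- a)) * flat 0 ((-1) * t + b)) \<in> flat_algebra"
    by (intro flat_algebra.intros)
  then show ?thesis
    using smooth_real_flat_algebra by (simp add: bump_def[abs_def])
qed

lemma bump_pos: "a < t \<Longrightarrow> t < b \<Longrightarrow> 0 < bump a b t"
  by (simp add: bump_def flat_pos)

lemma bump_eq_0: "t \<notin> {a<..<b} \<Longrightarrow> bump a b t = 0"
  by (auto simp: bump_def flat_nonpos)

lemma bump_unit_interval_cpt:
  assumes "0 < a" "b < 1" shows "bump a b \<in> smooth_unit_interval_cpt"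
proof -
  have "compact {a..b} \<and> {a..b} \<subseteq> {0<..<1} \<and> (\<forall>t\<in>{0<..<1} - {a..b}. bump a b t = 0)"
    using assms by (auto simp: bump_eq_0)
  then show ?thesis
    using smooth_real_bump[of a b]
    unfolding smooth_unit_interval_cpt_def smooth_unit_interval_def smooth_real_def by blast
qed

section \<open>Products of one-variable functions\<close>

text \<open>A partial derivative in direction \<open>j\<close> only replaces the factor
  \<open>g j\<close> by its derivative. Hence the products of smooth one-variable functions form a
  class \<open>D\<close> that contains all iterated partial derivatives of its members, and
  continuity and differentiability need checking only for members of \<open>D\<close>.\<close>

lemma smooth_Rn_prod:
  assumes "\<And>i. smooth_real (g i)"
  shows "smooth_Rn N (\<lambda>x. \<Prod>i<N. g i (x i))"
proof -
  define D where "D = {f. \<exists>g. (\<forall>i. smooth_real (g i)) \<and> f = (\<lambda>x::nat \<Rightarrow> real. \<Prod>i<N. g i (x i))}"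
  have split: "(\<Prod>i<N. g i ((x(j := t)) i)) = g j t * (\<Prod>i\<in>{..<N} - {j}. g i (x i))"
    if "j < N" for g :: "nat \<Rightarrow> real \<Rightarrow> real" and x j t
    using that by (subst prod.remove[of _ j]) (auto intro!: prod.cong)
  have partial: "partial_deriv j f \<in> D" if "j < N" "f \<in> D" for j f
  proof -
    from that obtain g where g: "\<And>i. smooth_real (g i)" and f: "f = (\<lambda>x. \<Prod>i<N. g i (x i))"
      by (auto simp: D_def)
    let ?g = "g(j := deriv (g j))"
    have "partial_deriv j f x = (\<Prod>i<N. ?g i (x i))" for x
    proof -
      have "partial_deriv j f x = deriv (g j) (x j) * (\<Prod>i\<in>{..<N} - {j}. g i (x i))"
        unfolding partial_deriv_def f split[OF that(1)]
        by (rule DERIV_imp_deriv) (auto intro!: DERIV_cmult_right smooth_real_has_deriv g)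
      \<comment> \<open>Writing \<open>x\<close> as the trivial update \<open>x(j := x j)\<close>
        lets \<open>split\<close> isolate the factor \<open>j\<close> on this side too.\<close>
      also have "\<dots> = (\<Prod>i<N. ?g i ((x(j := x j)) i))"
        unfolding split[OF that(1)] by (auto intro!: prod.cong)
      finally show ?thesis by simp
    qed
    moreover have "\<forall>i. smooth_real (?g i)" using g smooth_real_deriv by simp
    ultimately show ?thesis unfolding D_def by blast
  qed
  have "foldr partial_deriv js f \<in> D" if "set js \<subseteq> {..<N}" "f \<in> D" for js f
    using that by (induction js) (auto intro: partial)
  moreover have "continuous_map (subtopology (Euclidean_space N) W) euclideanreal f" if "f \<in> D" for f W
  proof -
    from that obtain g where g: "\<And>i. smooth_real (g i)" and f: "f = (\<lambda>x. \<Prod>i<N. g i (x i))"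
      by (auto simp: D_def)
    have "continuous_map (powertop_real UNIV) euclideanreal (\<lambda>x. g i (x i))" for i
    proof -
      have "continuous_map (powertop_real UNIV) euclideanreal (\<lambda>x. x i)"
        by (rule continuous_map_product_projection[of i UNIV "\<lambda>_. euclideanreal"]) simp
      moreover have "continuous_map euclideanreal euclideanreal (g i)"
        using smooth_real_continuous[OF g] by simp
      ultimately show ?thesis
        using continuous_map_compose[of _ _ "\<lambda>x. x i" _ "g i"] by (simp add: o_def)
    qed
    then show ?thesis
      unfolding f Euclidean_space_def
      by (intro continuous_map_from_subtopology continuous_map_prod) auto
  qed
  moreover have "(\<lambda>t. f (x(j := t))) differentiable (at (x j))" if "j < N" "f \<in> D" for f j x
  proof -
    from that obtain g where g: "\<And>i. smooth_real (g i)" and f: "f = (\<lambda>x. \<Prod>i<N. g i (x i))"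
      by (auto simp: D_def)
    show ?thesis
      unfolding f split[OF that(1)]
      using DERIV_cmult_right[OF smooth_real_has_deriv[OF g[of j]]] real_differentiable_def by fast
  qed
  moreover have "(\<lambda>x. \<Prod>i<N. g i (x i)) \<in> D" using assms unfolding D_def by blast
  ultimately show ?thesis unfolding smooth_Rn_def smooth_on_Rn_def by blast
qed

section \<open>Topology of cones and of chart balls\<close>

lemma topspace_cone [simp]: "topspace (cone_topology L) = cone_points (topspace L)"
proof -
  have "{(z, t). z \<in> topspace L \<and> 0 \<le> t \<and> cone_class z t \<in> cone_points (topspace L)}
      = topspace (prod_topology L (top_of_set {0..}))"
    by (auto simp: cone_class_def cone_points_def)
  then have "openin (cone_topology L) (cone_points (topspace L))"
    unfolding openin_cone_topology by (metis openin_topspace subset_refl)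
  then show ?thesis
    by (metis openin_cone_topology openin_subset openin_topspace subset_antisym)
qed

lemma topspace_cone_ball:
  "topspace (base (cone_ball L \<epsilon>)) = insert Apex {Ray z t | z t. z \<in> topspace (base L) \<and> 0 < t \<and> t < \<epsilon>}"
  by (auto simp: cone_ball_def cone_points_def)

lemma continuous_map_cone_class:
  "continuous_map (prod_topology L (top_of_set {0..})) (cone_topology L) (\<lambda>(z, t). cone_class z t)"
proof (clarsimp simp: continuous_map_def, intro conjI allI impI)
  show "(\<lambda>(z, t). cone_class z t) \<in> topspace L \<times> {0..} \<rightarrow> cone_points (topspace L)"
    by (auto simp: cone_class_def cone_points_def)
next
  fix W assume W: "openin (cone_topology L) W"
  have "{p \<in> topspace L \<times> {0..}. (case p of (z, t) \<Rightarrow> cone_class z t) \<in> W}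
      = {(z, t). z \<in> topspace L \<and> 0 \<le> t \<and> cone_class z t \<in> W}" by auto
  with W show "openin (prod_topology L (top_of_set {0..}))
      {p \<in> topspace L \<times> {0..}. (case p of (z, t) \<Rightarrow> cone_class z t) \<in> W}"
    by (simp add: openin_cone_topology)
qed

text \<open>The truncated cone is, up to the apex, the image of the compact product of the link with
  \<open>[0, m]\<close> under the quotient map; \<open>m < \<epsilon>\<close> keeps it inside the
  open cone.\<close>

lemma compactin_cone_ball:
  assumes "compact_space (base L)" "m < \<epsilon>"
  shows "compactin (base (cone_ball L \<epsilon>))
           (insert Apex {Ray z t | z t. z \<in> topspace (base L) \<and> 0 < t \<and> t \<le> m})"
    (is "compactin _ ?S")
proof -
  let ?Q = "topspace (base L) \<times> {0..m}"
  have "compactin (prod_topology (base L) (top_of_set {0..})) ?Q"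
    using assms by (auto simp: compactin_Times compact_space_def compactin_subtopology)
  then have "compactin (cone_topology (base L)) ((\<lambda>(z, t). cone_class z t) ` ?Q)"
    by (rule image_compactin[OF _ continuous_map_cone_class])
  \<comment> \<open>The apex is added separately because the image misses it when the link is
    empty.\<close>
  then have "compactin (cone_topology (base L)) ({Apex} \<union> (\<lambda>(z, t). cone_class z t) ` ?Q)"
    by (intro compactin_Un) (auto simp: cone_points_def)
  moreover have "?S = {Apex} \<union> (\<lambda>(z, t). cone_class z t) ` ?Q"
  proof
    have "Ray z t \<in> (\<lambda>(z, t). cone_class z t) ` ?Q" if "z \<in> topspace (base L)" "0 < t" "t \<le> m" for z t
      by (rule image_eqI[of _ _ "(z, t)"]) (use that in \<open>auto simp: cone_class_def\<close>)
    then show "?S \<subseteq> {Apex} \<union> (\<lambda>(z, t). cone_class z t) ` ?Q" by blast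
  qed (auto simp: cone_class_def)
  ultimately show ?thesis
    using assms(2) by (auto simp: cone_ball_def compactin_subtopology)
qed

text \<open>In the quotient topology, openness is tested on the preimage, here the product of the
  link with \<open>[0, m)\<close>.\<close>

lemma openin_cone_ball_inner:
  assumes "0 < m"
  shows "openin (base (cone_ball L \<epsilon>))
     (insert Apex {Ray z t | z t. z \<in> topspace (base L) \<and> 0 < t \<and> t < \<epsilon> \<and> t < m})"
proof -
  let ?W = "insert Apex {Ray z t | z t. z \<in> topspace (base L) \<and> 0 < t \<and> t < m}"
  have "{(z, t). z \<in> topspace (base L) \<and> 0 \<le> t \<and> cone_class z t \<in> ?W} = topspace (base L) \<times> ({0..} \<inter> {..<m})"
    using assms by (auto simp: cone_class_def)
  moreover have "openin (prod_topology (base L) (top_of_set {0..})) (topspace (base L) \<times> ({0..} \<inter> {..<m}))"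
    by (intro openin_prod_Times_iff[THEN iffD2] disjI2 conjI openin_topspace openin_open_Int open_lessThan)
  ultimately have "openin (cone_topology (base L)) ?W"
    by (auto simp: openin_cone_topology cone_points_def)
  then show ?thesis
    unfolding cone_ball_def decomposed.simps openin_subtopology by (intro exI conjI) auto
qed

lemma openin_cone_ball_outer:
  assumes "0 \<le> m"
  shows "openin (base (cone_ball L \<epsilon>))
     {Ray z t | z t. z \<in> topspace (base L) \<and> 0 < t \<and> t < \<epsilon> \<and> m < t}"
proof -
  let ?W = "{Ray z t | z t. z \<in> topspace (base L) \<and> 0 < t \<and> m < t}"
  have "{(z, t). z \<in> topspace (base L) \<and> 0 \<le> t \<and> cone_class z t \<in> ?W} = topspace (base L) \<times> ({0..} \<inter> {m<..})"
    using assms by (auto simp: cone_class_def)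
  moreover have "openin (prod_topology (base L) (top_of_set {0..})) (topspace (base L) \<times> ({0..} \<inter> {m<..}))"
    by (intro openin_prod_Times_iff[THEN iffD2] disjI2 conjI openin_topspace openin_open_Int open_greaterThan)
  ultimately have "openin (cone_topology (base L)) ?W"
    by (auto simp: openin_cone_topology cone_points_def)
  then show ?thesis
    unfolding cone_ball_def decomposed.simps openin_subtopology by (intro exI conjI) auto
qed

text \<open>Inside the product of countably many real lines, the box is a product of closed
  intervals, with the factor \<open>{0}\<close> from index \<open>n\<close> on; Tychonoff's theorem
  applies.\<close>

lemma compactin_Euclidean_box:
  "compactin (Euclidean_space n) {y \<in> topspace (Euclidean_space n). \<forall>i<n. \<bar>y i - p i\<bar> \<le> s}"
proof -
  let ?I = "\<lambda>i. if i < n then {p i - s..p i + s} else {0::real}"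
  have "compactin (powertop_real UNIV) (PiE UNIV ?I)"
    by (auto simp: compactin_PiE)
  moreover have "PiE UNIV ?I = {y \<in> topspace (Euclidean_space n). \<forall>i<n. \<bar>y i - p i\<bar> \<le> s}"
    by (auto simp: topspace_Euclidean_space PiE_iff abs_le_iff split: if_splits)
      (smt (verit, best) not_le)+
  moreover have "PiE UNIV ?I \<subseteq> topspace (Euclidean_space n)" 
    by (auto simp: topspace_Euclidean_space PiE_iff split: if_splits)
  ultimately show ?thesis
    by (simp add: Euclidean_space_def compactin_subtopology)
qed

section \<open>Bump functions in a local trivialization\<close>

lemma image_Collect_mem: "A \<subseteq> f ` U \<Longrightarrow> f ` {u \<in> U. f u \<in> A} = A"
  by blast

text \<open>Only the trivialization at \<open>x\<close> enters: the function constructed is nonzero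
  at \<open>x\<close> and zero at \<open>u\<close>, wherever \<open>u\<close> lies relative to
  \<open>U\<close>.\<close>

lemma trivialization_separates:
  fixes X :: "'a decomposed" and L :: "'b decomposed"
  assumes haus: "Hausdorff_space (base X)" and alg: "smooth_algebra (base X) C"
    and triv: "local_trivialization X x S U B L \<phi>"
    and cpt: "compact_space (base L)"
    and radial: "\<forall>g\<in>smooth_unit_interval_cpt. (\<lambda>c. case c of Apex \<Rightarrow> 0 | Ray z t \<Rightarrow> g t) \<in> K"
    and model: "sheaf_sections (base X) C U =
          {f. \<exists>F \<in> product_smooth (subtopology (base X) B) (stratum_smooth S B)
                     (base (cone_ball L 1)) K. \<forall>u\<in>U. f u = F (\<phi> u)}"
    and u: "u \<noteq> x"
  shows "\<exists>f\<in>C. f x \<noteq> f u"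
proof -

  \<comment> \<open>Coordinates on the trivialized neighborhood\<close>
  define n where "n = sdim S"
  let ?E = "Euclidean_space n"
  from triv have U: "openin (base X) U" "x \<in> U" and xS: "x \<in> pts S"
    and ball: "open_ball_around (base X) S x B"
    and hom: "homeomorphic_map (subtopology (base X) U)
       (prod_topology (subtopology (base X) B) (base (cone_ball L 1))) \<phi>"
    and \<phi>S: "\<phi> ` (U \<inter> pts S) = B \<times> {Apex}"
    by (simp_all add: local_trivialization_def)
  from ball obtain \<kappa> r where "is_chart (base X) (pts S) n (B, \<kappa>)"
    and trans: "\<forall>c\<in>atlas S. smooth_transition n c (B, \<kappa>)"
    and im: "\<kappa> ` B = {y \<in> topspace ?E. (\<Sum>i<n. (y i - \<kappa> x i)\<^sup>2) < r\<^sup>2}"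
    unfolding open_ball_around_def n_def by blast
  then have hom_\<kappa>: "homeomorphic_map (subtopology (base X) B) (subtopology ?E (\<kappa> ` B)) \<kappa>"
    and BX: "B \<subseteq> topspace (base X)"
    by (simp_all add: is_chart_def) (metis openin_subset topspace_subtopology le_infE)
  have \<kappa>_mem: "\<kappa> y \<in> topspace ?E" if "y \<in> B" for y
    using imageI[OF that, of \<kappa>] unfolding im by simp
  have inj_\<kappa>: "inj_on \<kappa> B"
    using homeomorphic_imp_injective_map[OF hom_\<kappa>] BX by (simp add: Int_absorb1)
  have UX: "U \<subseteq> topspace (base X)" using U(1) openin_subset by blast
  have inj_\<phi>: "inj_on \<phi> U"
    using homeomorphic_imp_injective_map[OF hom] UX by (simp add: Int_absorb1)
  have \<phi>_im: "\<phi> ` U = B \<times> topspace (base (cone_ball L 1))"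
    using homeomorphic_imp_surjective_map[OF hom] UX BX by (simp add: Int_absorb1)
  then have \<phi>_mem: "\<phi> v \<in> B \<times> topspace (base (cone_ball L 1))" if "v \<in> U" for v
    using that by blast
  \<comment> \<open>A trivialization need not send \<open>x\<close> to \<open>(x, Apex)\<close>, so
    \<open>b\<close> may differ from \<open>x\<close>. The bump is therefore centered at
    \<open>q\<close>, which may be off the center \<open>\<kappa> x\<close> of the chart
    ball.\<close>
  obtain b where b: "\<phi> x = (b, Apex)" "b \<in> B" using \<phi>S U xS by blast
  define q where "q = \<kappa> b"
  have q: "(\<Sum>i<n. (q i - \<kappa> x i)\<^sup>2) < r\<^sup>2" using b im by (auto simp: q_def)
  \<comment> \<open>If \<open>u\<close> lies over the apex, injectivity of \<open>\<phi>\<close> and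
    \<open>\<kappa>\<close> gives a coordinate of index below \<open>n\<close> that differs from
    that of \<open>q\<close>; otherwise the height of \<open>u\<close> on its ray serves as
    \<open>m0\<close>. The values \<open>1\<close> and \<open>1/2\<close> elsewhere are
    arbitrary.\<close>
  have "\<exists>s0>0. \<exists>m0\<in>{0<..<1}. u \<in> U \<longrightarrow>
      (\<exists>i<n. s0 \<le> \<bar>\<kappa> (fst (\<phi> u)) i - q i\<bar>) \<or> (\<exists>z t. snd (\<phi> u) = Ray z t \<and> m0 \<le> t)"
  proof (cases "u \<in> U")
    case True
    obtain b' c where c: "\<phi> u = (b', c)" by fastforce
    then have b': "b' \<in> B" "c \<in> topspace (base (cone_ball L 1))" using \<phi>_mem[OF True] by simp_all
    show ?thesis
    proof (cases c)
      case Apex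
      then have "b' \<noteq> b" using c b u True U inj_\<phi> by (metis inj_onD)
      then have "\<kappa> b' \<noteq> q" unfolding q_def using inj_\<kappa> b b' by (metis inj_onD)
      moreover have "\<kappa> b' \<in> topspace ?E" "q \<in> topspace ?E" using \<kappa>_mem b b' by (simp_all add: q_def)
      ultimately obtain i where "\<kappa> b' i \<noteq> q i" "i < n"
        unfolding topspace_Euclidean_space mem_Collect_eq fun_eq_iff by (metis not_le)
      then show ?thesis
        using c by (intro exI[of _ "\<bar>\<kappa> b' i - q i\<bar>"] conjI bexI[of _ "1/2"]) auto
    next
      case (Ray z t)
      then have "0 < t" "t < 1" using b' by (auto simp: topspace_cone_ball)
      then show ?thesis using c Ray by (intro exI[of _ 1] conjI bexI[of _ t]) auto
    qed
  next
    case False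
    then show ?thesis by (intro exI[of _ 1] conjI bexI[of _ "1/2"]) auto
  qed
  then obtain s0 m where s0: "0 < s0" and m: "0 < m" "m < 1"
    and sep: "u \<in> U \<Longrightarrow> (\<exists>i<n. s0 \<le> \<bar>\<kappa> (fst (\<phi> u)) i - q i\<bar>) \<or> (\<exists>z t. snd (\<phi> u) = Ray z t \<and> m \<le> t)"
    by (metis greaterThanLessThan_iff)
  \<comment> \<open>The sum bounds the squared distance from \<open>\<kappa> x\<close> to any point
    of the box of half-width \<open>s\<close> about \<open>q\<close>. It tends to a value below
    \<open>r\<^sup>2\<close>, so a small box fits inside the round ball.\<close>
  have "((\<lambda>s. \<Sum>i<n. (\<bar>q i - \<kappa> x i\<bar> + s)\<^sup>2) \<longlongrightarrow> (\<Sum>i<n. (\<bar>q i - \<kappa> x i\<bar> + 0)\<^sup>2)) (at_right 0)"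
    by (intro tendsto_intros)
  then have "eventually (\<lambda>s. (\<Sum>i<n. (\<bar>q i - \<kappa> x i\<bar> + s)\<^sup>2) < r\<^sup>2) (at_right 0)"
    by (rule order_tendstoD) (use q in simp)
  moreover have "eventually (\<lambda>s. s \<in> {0<..<s0}) (at_right 0)"
    using s0 by (rule eventually_at_right_real)
  ultimately have "eventually (\<lambda>s. (\<Sum>i<n. (\<bar>q i - \<kappa> x i\<bar> + s)\<^sup>2) < r\<^sup>2 \<and> s \<in> {0<..<s0}) (at_right 0)"
    by (rule eventually_conj)
  then obtain s where s: "0 < s" "s < s0" "(\<Sum>i<n. (\<bar>q i - \<kappa> x i\<bar> + s)\<^sup>2) < r\<^sup>2"
    unfolding greaterThanLessThan_iff using eventually_happens'[OF trivial_limit_at_right_real] by blast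

  \<comment> \<open>A compact set to carry the support\<close>
  define box where "box = {y \<in> topspace ?E. \<forall>i<n. \<bar>y i - q i\<bar> \<le> s}"
  have "box \<subseteq> \<kappa> ` B"
  proof
    fix y assume y: "y \<in> box"
    have "(\<Sum>i<n. (y i - \<kappa> x i)\<^sup>2) \<le> (\<Sum>i<n. (\<bar>q i - \<kappa> x i\<bar> + s)\<^sup>2)"
    proof (rule sum_mono)
      fix i assume "i \<in> {..<n}"
      then have "\<bar>y i - q i\<bar> \<le> s" using y by (auto simp: box_def)
      then have "\<bar>y i - \<kappa> x i\<bar> \<le> \<bar>\<bar>q i - \<kappa> x i\<bar> + s\<bar>" by linarith
      then show "(y i - \<kappa> x i)\<^sup>2 \<le> (\<bar>q i - \<kappa> x i\<bar> + s)\<^sup>2" by (simp add: abs_le_square_iff)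
    qed
    with s y show "y \<in> \<kappa> ` B" unfolding im box_def by auto
  qed
  define KB where "KB = {y \<in> B. \<kappa> y \<in> box}"
  have "\<kappa> ` KB = box" using \<open>box \<subseteq> \<kappa> ` B\<close> by (auto simp: KB_def)
  moreover have "compactin (subtopology ?E (\<kappa> ` B)) box"
    using \<open>box \<subseteq> \<kappa> ` B\<close> compactin_Euclidean_box[of n q s] by (simp add: compactin_subtopology box_def)
  ultimately have KB: "compactin (subtopology (base X) B) KB"
    using homeomorphic_map_compactness_eq[OF hom_\<kappa>, of KB] BX by (auto simp: KB_def)
  define KC where "KC = insert Apex {Ray z t | z t. z \<in> topspace (base L) \<and> 0 < t \<and> t \<le> m}"
  have KC: "compactin (base (cone_ball L 1)) KC"
    unfolding KC_def by (rule compactin_cone_ball[OF cpt m(2)])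
  define A where "A = KB \<times> KC"
  define Z where "Z = {y \<in> U. \<phi> y \<in> A}"
  have "A \<subseteq> \<phi> ` U"
    unfolding \<phi>_im A_def using compactin_subset_topspace[OF KC] by (auto simp: KB_def)
  then have "\<phi> ` Z = A" unfolding Z_def by (rule image_Collect_mem)
  moreover have "compactin (prod_topology (subtopology (base X) B) (base (cone_ball L 1))) A"
    using KB KC by (simp add: A_def compactin_Times)
  moreover have "Z \<subseteq> topspace (subtopology (base X) U)" using UX by (auto simp: Z_def)
  ultimately have "compactin (subtopology (base X) U) Z"
    using homeomorphic_map_compactness[OF hom] by metis
  then have Z: "closedin (base X) Z"
    using haus by (simp add: compactin_imp_closedin compactin_subtopology)

  txt \<open>
    Condition (3b) only provides radial functions vanishing near the apex. If \<open>g0\<close> is such a bump with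
    \<open>g0 > c0\<close> just below \<open>m\<close>, then \<open>flat 0 (c0 - g0 t)\<close> is positive near the apex and vanishes just
    below \<open>m\<close>, so cutting it off to zero beyond \<open>m\<close> keeps it smooth.
  \<close>
  define g0 where "g0 = bump (m / 2) ((m + 1) / 2)"
  define c0 where "c0 = g0 m / 2"
  have c0: "0 < c0" "c0 < g0 m" using bump_pos[of "m/2" m "(m+1)/2"] m by (auto simp: c0_def g0_def)
  have "isCont g0 m"
    using smooth_real_continuous[of g0 UNIV] smooth_real_bump
    by (simp add: g0_def continuous_on_eq_continuous_at)
  then have "eventually (\<lambda>t. c0 < g0 t) (nhds m)"
    using c0 by (metis order_tendstoD(1) tendsto_at_iff_tendsto_nhds isCont_def)
  then obtain d where d: "0 < d" "\<And>t. \<bar>t - m\<bar> < d \<Longrightarrow> c0 < g0 t"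
    by (auto simp: eventually_nhds_metric dist_real_def)
  \<comment> \<open>The maximum with 0 meets the assumption of
    \<open>openin_cone_ball_outer\<close>; above \<open>e\<close> and below \<open>m\<close> the
    bound \<open>c0 < g0 t\<close> is available.\<close>
  define e where "e = max 0 (m - d)"
  have e: "0 \<le> e" "e < m" "\<And>t. e < t \<Longrightarrow> t < m \<Longrightarrow> c0 < g0 t"
    using d m by (auto simp: e_def)
  define h :: "'b cone \<Rightarrow> real" where "h = (\<lambda>c. case c of Apex \<Rightarrow> 0 | Ray z t \<Rightarrow> g0 t)"
  have hK: "h \<in> K"
    using radial bump_unit_interval_cpt[of "m/2" "(m+1)/2"] m unfolding h_def g0_def by simp

  \<comment> \<open>The cutoff function on the product\<close>
  define P where "P = (\<lambda>y. \<Prod>i<n. bump (q i - s) (q i + s) (\<kappa> y i))"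
  have P0: "P y = 0" if "i < n" "s \<le> \<bar>\<kappa> y i - q i\<bar>" for y i
    unfolding P_def using that by (intro prod_zero bexI[of _ i] bump_eq_0) (auto simp: abs_le_iff)
  define F where "F = (\<lambda>(y, c). if \<exists>z t. c = Ray z t \<and> m \<le> t then 0 else P y * flat 0 (c0 - h c))"
  \<comment> \<open>Below height \<open>m\<close> the case distinction in \<open>F\<close>
    disappears, and \<open>F\<close> is one smooth function of the \<open>n\<close> chart
    coordinates and of \<open>h\<close>, which takes the last slot.\<close>
  have inner: "\<exists>n' k G f h'. smooth_Rn (n' + k) G \<and> (\<forall>i<n'. f i \<in> stratum_smooth S B) \<and> (\<forall>j<k. h' j \<in> K) \<and>
     (\<forall>(y, z)\<in>W. F (y, z) = G (tuple (n' + k) (\<lambda>i. if i < n' then f i y else h' (i - n') z)))"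
    if W: "\<And>y z t. (y, Ray z t) \<in> W \<Longrightarrow> t < m" for W
  proof -
    let ?g = "\<lambda>i. if i < n then bump (q i - s) (q i + s) else (\<lambda>t. flat 0 (c0 - t))"
    let ?G = "\<lambda>v. \<Prod>i<n + 1. ?g i (v i)"
    have "smooth_Rn (n + 1) ?G"
      by (rule smooth_Rn_prod) (simp add: smooth_real_bump smooth_real_flat_reflect)
    moreover have "(\<lambda>y. \<kappa> y i) \<in> stratum_smooth S B" if "i < n" for i
      using bspec[OF trans] that by (force simp: stratum_smooth_def smooth_transition_def n_def)
    moreover have "F (y, c) = ?G (tuple (n + 1) (\<lambda>i. if i < n then \<kappa> y i else h c))" if "(y, c) \<in> W" for y c
      using that by (auto simp: F_def P_def tuple_def dest: W)
    ultimately show ?thesis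
      using hK by (intro exI[of _ n] exI[of _ 1] exI[of _ ?G] exI[of _ "\<lambda>i y. \<kappa> y i"] exI[of _ "\<lambda>_. h"]) auto
  qed
  have outer: "\<exists>n' k G f h'. smooth_Rn (n' + k) G \<and> (\<forall>i<n'. f i \<in> stratum_smooth S B) \<and> (\<forall>j<k. h' j \<in> K) \<and>
     (\<forall>(y, z)\<in>W. F (y, z) = G (tuple (n' + k) (\<lambda>i. if i < n' then f i y else h' (i - n') z)))"
    if W: "\<And>y c. (y, c) \<in> W \<Longrightarrow> F (y, c) = 0" for W
  proof -
    \<comment> \<open>The zero function is written as a product with a single zero factor, hence
      \<open>k = 1\<close>: the product over no factors would be 1.\<close>
    let ?G = "\<lambda>v::nat \<Rightarrow> real. \<Prod>i<0 + 1. (\<lambda>_ _. 0) i (v i)"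
    have "smooth_Rn (0 + 1) ?G"
      by (rule smooth_Rn_prod) (auto intro!: smooth_real_flat_algebra flat_algebra.const)
    then show ?thesis
      using hK W by (intro exI[of _ 0] exI[of _ 1] exI[of _ ?G] exI[of _ "\<lambda>_. h"]) auto
  qed
  have F: "F \<in> product_smooth (subtopology (base X) B) (stratum_smooth S B) (base (cone_ball L 1)) K"
    unfolding product_smooth_def
  proof (intro CollectI ballI)
    fix p assume "p \<in> topspace (prod_topology (subtopology (base X) B) (base (cone_ball L 1)))"
    then obtain y c where p: "p = (y, c)" "y \<in> B" "c \<in> topspace (base (cone_ball L 1))"
      using BX by auto
    \<comment> \<open>The set over \<open>?I\<close> serves points below height \<open>m\<close>,
      the one over \<open>?O\<close> all others. Since \<open>?O\<close> starts at
      \<open>e < m\<close>, it is a neighborhood of the points at height exactly \<open>m\<close>,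
      where the two formulas for \<open>F\<close> meet.\<close>
    let ?T = "topspace (subtopology (base X) B)"
    let ?I = "insert Apex {Ray z t | z t. z \<in> topspace (base L) \<and> 0 < t \<and> t < 1 \<and> t < m}"
    let ?O = "{Ray z t | z t. z \<in> topspace (base L) \<and> 0 < t \<and> t < 1 \<and> e < t}"
    show "\<exists>W. openin (prod_topology (subtopology (base X) B) (base (cone_ball L 1))) W \<and> p \<in> W \<and>
        (\<exists>n' k G f h'. smooth_Rn (n' + k) G \<and> (\<forall>i<n'. f i \<in> stratum_smooth S B) \<and> (\<forall>j<k. h' j \<in> K) \<and>
     (\<forall>(y, z)\<in>W. F (y, z) = G (tuple (n' + k) (\<lambda>i. if i < n' then f i y else h' (i - n') z))))"
    proof (cases "\<exists>z t. c = Ray z t \<and> m \<le> t")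
      case False
      show ?thesis
      proof (intro exI[of _ "?T \<times> ?I"] conjI inner)
        show "openin (prod_topology (subtopology (base X) B) (base (cone_ball L 1))) (?T \<times> ?I)"
          by (intro openin_prod_Times_iff[THEN iffD2] disjI2 conjI openin_topspace openin_cone_ball_inner m(1))
        show "p \<in> ?T \<times> ?I" using p False BX by (auto simp: topspace_cone_ball)
      qed auto
    next
      case True
      show ?thesis
      proof (intro exI[of _ "?T \<times> ?O"] conjI outer)
        show "openin (prod_topology (subtopology (base X) B) (base (cone_ball L 1))) (?T \<times> ?O)"
          by (intro openin_prod_Times_iff[THEN iffD2] disjI2 conjI openin_topspace openin_cone_ball_outer e(1))
        show "p \<in> ?T \<times> ?O" using p True BX e by (auto simp: topspace_cone_ball)
        show "F (y, c) = 0" if "(y, c) \<in> ?T \<times> ?O" for y c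
          using that e(3) by (auto simp: F_def h_def flat_nonpos less_imp_le not_le)
      qed
    qed
  qed

  \<comment> \<open>Extension by zero to the whole space\<close>
  define f where "f = (\<lambda>v. if v \<in> U then F (\<phi> v) else 0)"
  have "f \<in> sheaf_sections (base X) C U"
    unfolding model using F by (auto simp: f_def)
  have f0: "f v = 0" if "v \<notin> Z" for v
  proof (cases "v \<in> U")
    case True
    obtain y c where yc: "\<phi> v = (y, c)" by fastforce
    then have "y \<in> B" "c \<in> topspace (base (cone_ball L 1))" using \<phi>_mem[OF True] by simp_all
    with that True yc have "y \<notin> KB \<or> (\<exists>z t. c = Ray z t \<and> m \<le> t)"
      by (auto simp: Z_def A_def KC_def topspace_cone_ball)
    moreover have "P y = 0" if y: "y \<notin> KB"
    proof -
      obtain i where "i < n" "s \<le> \<bar>\<kappa> y i - q i\<bar>"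
        using y \<open>y \<in> B\<close> \<kappa>_mem[of y] unfolding KB_def box_def by (auto simp: not_le less_imp_le)
      then show ?thesis by (rule P0)
    qed
    ultimately show ?thesis using True yc by (auto simp: f_def F_def)
  qed (simp add: f_def)
  have "f \<in> sheaf_sections (base X) C (topspace (base X))"
    unfolding sheaf_sections_def
  proof (intro CollectI ballI)
    fix v assume v: "v \<in> topspace (base X)"
    show "\<exists>V. openin (base X) V \<and> v \<in> V \<and> V \<subseteq> topspace (base X) \<and> (\<exists>g\<in>C. \<forall>y\<in>V. f y = g y)"
    proof (cases "v \<in> U")
      case True
      with \<open>f \<in> sheaf_sections (base X) C U\<close> UX show ?thesis
        unfolding sheaf_sections_def by blast
    next
      case False
      \<comment> \<open>At a point outside \<open>U\<close>, possibly on its boundary, the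
        complement of the closed set \<open>Z\<close> is a neighborhood on which \<open>f\<close>
        agrees with the zero function.\<close>
      have "(\<lambda>_. 0) \<in> C" using alg by (simp add: smooth_algebra_def subalgebra_C0_def)
      with False v f0 Z show ?thesis
        by (intro exI[of _ "topspace (base X) - Z"] conjI bexI[of _ "\<lambda>_. 0"]) (auto simp: Z_def)
    qed
  qed
  then have "f \<in> C" using alg by (auto simp: smooth_algebra_def germ_defined_def)
  moreover have "f x \<noteq> 0"
  proof -
    \<comment> \<open>Each bump is evaluated at its center, and at the apex \<open>h\<close> is 0,
      so the radial factor is \<open>flat 0 c0\<close>.\<close>
    have "0 < P b" unfolding P_def using s by (intro prod_pos) (simp add: bump_pos q_def)
    then show ?thesis using U b c0 flat_pos[of c0 0] by (simp add: f_def F_def h_def)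
  qed
  moreover have "f u = 0"
  proof (cases "u \<in> U")
    case True
    \<comment> \<open>Either a coordinate is at distance at least \<open>s0 > s\<close> from that of
      \<open>q\<close>, so \<open>P\<close> vanishes, or the height is at least \<open>m\<close>,
      where \<open>F\<close> is cut off.\<close>
    from sep[OF this] s(2) P0[of _ "fst (\<phi> u)"] show ?thesis
      by (force simp: f_def F_def split: prod.splits)
  qed (simp add: f_def)
  ultimately show ?thesis by metis
qed

theorem corollary2p9:
  fixes X :: "'a decomposed" and C :: "('a \<Rightarrow> real) set"
  assumes "stratified_space TYPE('b) X"
    and "smooth_structure TYPE('b) X C"
  shows "separates_points (base X) C"
proof -
  have haus: "Hausdorff_space (base X)"
    using assms(1) by (simp add: stratified_space_def locally_conical_def decomposed_space_def)
  have alg: "smooth_algebra (base X) C"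
    and local: "\<And>x. x \<in> topspace (base X) \<Longrightarrow>
      smooth_local_model (smooth_cone :: 'b decomposed \<Rightarrow> ('b cone \<Rightarrow> real) set \<Rightarrow> bool) X C x"
    using assms(2) by (simp_all add: smooth_structure_def smooth_structure_rel_def)
  have "\<exists>f\<in>C. f x \<noteq> f y" if "x \<in> topspace (base X)" "y \<noteq> x" for x y
  proof -
    from local[OF that(1)] obtain S U B \<phi> and L :: "'b decomposed" and K
      where triv: "local_trivialization X x S U B L \<phi>" and K: "smooth_cone L K"
        and model: "sheaf_sections (base X) C U =
          {f. \<exists>F \<in> product_smooth (subtopology (base X) B) (stratum_smooth S B)
                     (base (cone_ball L 1)) K. \<forall>u\<in>U. f u = F (\<phi> u)}"
      unfolding smooth_local_model_def by blast
    \<comment> \<open>Compactness is read off \<open>smooth_cone\<close>, because the link here is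
      the one of the smooth local model, which need not be the one supplied by
      \<open>stratified_space\<close>.\<close>
    from K have "compact_space (base L)"
      "\<forall>g\<in>smooth_unit_interval_cpt. (\<lambda>c. case c of Apex \<Rightarrow> 0 | Ray z t \<Rightarrow> g t) \<in> K"
      by (auto elim: smooth_cone.cases)
    then show ?thesis
      by (rule trivialization_separates[OF haus alg triv _ _ model that(2)])
  qed
  then show ?thesis unfolding separates_points_def by metis
qed

end
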